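(* The category of left skew rings and the category of left weak rings are canonically isomorphic. The canonical isomorphism associates to every left skew ring $(R,+,\circ)$ the left weak ring $(R,+,\cdot)$, where $\cdot$ is the binary operation on $R$ defined by $a\cdot b=-a+a\circ b$ for all $a,b\in R$, and associates to each left skew ring morphism $f\colon R\to S$ the same mapping $f$.
   Context: A left skew ring is an algebra $(R,+,-,0,\circ)$ where $(R,+,-,0)$ is a (not necessarily abelian) group and $\circ$ is a binary operation on $R$ that is associative, i.e. $a\circ(b\circ c)=(a\circ b)\circ c$, and left skew distributive, i.e. $a\circ(b+c)=(a\circ b)-a+(a\circ c)$, for all $a,b,c\in R$. (No two-sided identity for $\circ$ is required.) Left skew ring morphisms are the mappings that preserve $+$ and $\circ$. A left weak ring is an algebra $(W,+,-,0,\cdot)$ where $(W,+,-,0)$ is a (not necessarily abelian) group and $\cdot$ is a binary operation on $W$ that is left weakly associative, i.e. $(a+a\cdot b)\cdot c=a\cdot(b\cdot c)$, and left distributive, i.e. $a\cdot(b+c)=a\cdot b+a\cdot c$, for all $a,b,c\in W$. Left weak ring morphisms are the mappings that preserve $+$ and $\cdot$. An isomorphism of categories is a functor that has a two-sided inverse functor (strictly, not just up to natural isomorphism). *)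

theory Defs
  imports "HOL-Algebra.Group"
begin

section \<open>Left skew rings and left weak rings\<close>

text \<open>
  A (not necessarily abelian) group with one further binary operation. The group part is that of
  HOL-Algebra, but it is written additively here, as is usual for skew rings; neither the zero
  nor the negation needs a separate datum (zero is the field \<^term>\<open>one\<close>, negation is \<^term>\<open>m_inv\<close>).
\<close>

record 'a op_group = "'a monoid" +
  bop :: "'a \<Rightarrow> 'a \<Rightarrow> 'a"  (infixl \<open>\<odot>\<index>\<close> 75)

notation mult (infixl \<open>\<oplus>\<index>\<close> 65)
notation m_inv (\<open>\<ominus>\<index> _\<close> [81] 80)

locale left_skew_ring = group R for R :: "('a, 'm) op_group_scheme" (structure) +
  assumes circ_closed: "\<lbrakk>a \<in> carrier R; b \<in> carrier R\<rbrakk> \<Longrightarrow> a \<odot> b \<in> carrier R"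
    and circ_assoc: "\<lbrakk>a \<in> carrier R; b \<in> carrier R; c \<in> carrier R\<rbrakk> \<Longrightarrow>
      a \<odot> (b \<odot> c) = (a \<odot> b) \<odot> c"
    and circ_skew_distrib: "\<lbrakk>a \<in> carrier R; b \<in> carrier R; c \<in> carrier R\<rbrakk> \<Longrightarrow>
      a \<odot> (b \<oplus> c) = ((a \<odot> b) \<oplus> (\<ominus> a)) \<oplus> (a \<odot> c)"

locale left_weak_ring = group W for W :: "('a, 'm) op_group_scheme" (structure) +
  assumes dot_closed: "\<lbrakk>a \<in> carrier W; b \<in> carrier W\<rbrakk> \<Longrightarrow> a \<odot> b \<in> carrier W"
    and dot_weak_assoc: "\<lbrakk>a \<in> carrier W; b \<in> carrier W; c \<in> carrier W\<rbrakk> \<Longrightarrow>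
      (a \<oplus> (a \<odot> b)) \<odot> c = a \<odot> (b \<odot> c)"
    and dot_distrib: "\<lbrakk>a \<in> carrier W; b \<in> carrier W; c \<in> carrier W\<rbrakk> \<Longrightarrow>
      a \<odot> (b \<oplus> c) = (a \<odot> b) \<oplus> (a \<odot> c)"

definition op_hom :: "('a, 'm) op_group_scheme \<Rightarrow> ('b, 'n) op_group_scheme \<Rightarrow> ('a \<Rightarrow> 'b) set" where
  "op_hom R S = {f \<in> hom R S.
     \<forall>a \<in> carrier R. \<forall>b \<in> carrier R. f (a \<odot>\<^bsub>R\<^esub> b) = f a \<odot>\<^bsub>S\<^esub> f b}"


section \<open>Categories, functors, isomorphisms of categories\<close>

record ('o, 'm) cat =
  Obj :: "'o set"
  Arr :: "'m set"
  Dom :: "'m \<Rightarrow> 'o"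
  Cod :: "'m \<Rightarrow> 'o"
  Ident :: "'o \<Rightarrow> 'm"
  Cmp :: "'m \<Rightarrow> 'm \<Rightarrow> 'm"  \<comment> \<open>\<open>Cmp C g f\<close> is \<open>g\<close> after \<open>f\<close>\<close>

locale category =
  fixes C :: "('o, 'm) cat"
  assumes dom_in: "f \<in> Arr C \<Longrightarrow> Dom C f \<in> Obj C"
    and cod_in: "f \<in> Arr C \<Longrightarrow> Cod C f \<in> Obj C"
    and ident_in: "X \<in> Obj C \<Longrightarrow> Ident C X \<in> Arr C"
    and dom_ident: "X \<in> Obj C \<Longrightarrow> Dom C (Ident C X) = X"
    and cod_ident: "X \<in> Obj C \<Longrightarrow> Cod C (Ident C X) = X"
    and cmp_in: "\<lbrakk>f \<in> Arr C; g \<in> Arr C; Cod C f = Dom C g\<rbrakk> \<Longrightarrow> Cmp C g f \<in> Arr C"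
    and dom_cmp: "\<lbrakk>f \<in> Arr C; g \<in> Arr C; Cod C f = Dom C g\<rbrakk> \<Longrightarrow> Dom C (Cmp C g f) = Dom C f"
    and cod_cmp: "\<lbrakk>f \<in> Arr C; g \<in> Arr C; Cod C f = Dom C g\<rbrakk> \<Longrightarrow> Cod C (Cmp C g f) = Cod C g"
    and cmp_ident_right: "f \<in> Arr C \<Longrightarrow> Cmp C f (Ident C (Dom C f)) = f"
    and cmp_ident_left: "f \<in> Arr C \<Longrightarrow> Cmp C (Ident C (Cod C f)) f = f"
    and cmp_assoc: "\<lbrakk>f \<in> Arr C; g \<in> Arr C; h \<in> Arr C; Cod C f = Dom C g; Cod C g = Dom C h\<rbrakk> \<Longrightarrow>
      Cmp C h (Cmp C g f) = Cmp C (Cmp C h g) f"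

record ('o1, 'm1, 'o2, 'm2) ftor =
  on_obj :: "'o1 \<Rightarrow> 'o2"
  on_arr :: "'m1 \<Rightarrow> 'm2"

locale is_functor = C: category C + D: category D
  for C :: "('o1, 'm1) cat" and D :: "('o2, 'm2) cat" and F :: "('o1, 'm1, 'o2, 'm2) ftor" +
  assumes on_obj_in: "X \<in> Obj C \<Longrightarrow> on_obj F X \<in> Obj D"
    and on_arr_in: "f \<in> Arr C \<Longrightarrow> on_arr F f \<in> Arr D"
    and preserves_dom: "f \<in> Arr C \<Longrightarrow> Dom D (on_arr F f) = on_obj F (Dom C f)"
    and preserves_cod: "f \<in> Arr C \<Longrightarrow> Cod D (on_arr F f) = on_obj F (Cod C f)"
    and preserves_ident: "X \<in> Obj C \<Longrightarrow> on_arr F (Ident C X) = Ident D (on_obj F X)"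
    and preserves_cmp: "\<lbrakk>f \<in> Arr C; g \<in> Arr C; Cod C f = Dom C g\<rbrakk> \<Longrightarrow>
      on_arr F (Cmp C g f) = Cmp D (on_arr F g) (on_arr F f)"

definition id_ftor :: "('o, 'm, 'o, 'm) ftor" where
  "id_ftor = \<lparr>on_obj = \<lambda>X. X, on_arr = \<lambda>f. f\<rparr>"

definition comp_ftor ::
  "('o2, 'm2, 'o3, 'm3) ftor \<Rightarrow> ('o1, 'm1, 'o2, 'm2) ftor \<Rightarrow> ('o1, 'm1, 'o3, 'm3) ftor" where
  "comp_ftor G F = \<lparr>on_obj = \<lambda>X. on_obj G (on_obj F X), on_arr = \<lambda>f. on_arr G (on_arr F f)\<rparr>"

text \<open>
  Equality of functors out of \<open>C\<close>: the HOL functions \<^term>\<open>on_obj F\<close> and \<^term>\<open>on_arr F\<close> are total, and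
  their values off the objects and arrows of \<open>C\<close> are irrelevant.
\<close>

definition ftor_eq ::
  "('o1, 'm1) cat \<Rightarrow> ('o1, 'm1, 'o2, 'm2) ftor \<Rightarrow> ('o1, 'm1, 'o2, 'm2) ftor \<Rightarrow> bool" where
  "ftor_eq C F G \<longleftrightarrow>
     (\<forall>X \<in> Obj C. on_obj F X = on_obj G X) \<and> (\<forall>f \<in> Arr C. on_arr F f = on_arr G f)"

definition is_cat_isomorphism ::
  "('o1, 'm1) cat \<Rightarrow> ('o2, 'm2) cat \<Rightarrow> ('o1, 'm1, 'o2, 'm2) ftor \<Rightarrow> bool" where
  "is_cat_isomorphism C D F \<longleftrightarrow> is_functor C D F \<and>
     (\<exists>G. is_functor D C G \<and> ftor_eq C (comp_ftor G F) id_ftor \<and> ftor_eq D (comp_ftor F G) id_ftor)"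


section \<open>The two categories and the canonical functor\<close>

text \<open>
  The universe of sets is the type \<^typ>\<open>'a\<close>: objects are the structures whose carrier is a subset of
  it. A HOL record also carries values of the two operations off the carrier. To have exactly one
  record for each algebra (an isomorphism of categories must be bijective on objects), these
  values are required to be \<^term>\<open>undefined\<close>; likewise the mappings are \<^term>\<open>extensional\<close>.
\<close>

definition norm_op :: "'a set \<Rightarrow> ('a \<Rightarrow> 'a \<Rightarrow> 'a) \<Rightarrow> 'a \<Rightarrow> 'a \<Rightarrow> 'a" where
  "norm_op A p = (\<lambda>a b. if a \<in> A \<and> b \<in> A then p a b else undefined)"

definition normalized :: "'a op_group \<Rightarrow> bool" where
  "normalized R \<longleftrightarrow>
     norm_op (carrier R) (mult R) = mult R \<and> norm_op (carrier R) (bop R) = bop R"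

type_synonym 'a arrow = "'a op_group \<times> ('a \<Rightarrow> 'a) \<times> 'a op_group"

text \<open>
  The concrete category on a set \<open>\<O>\<close> of objects; an arrow is a mapping together with its domain
  and its codomain.
\<close>

definition concrete_cat :: "'a op_group set \<Rightarrow> ('a op_group, 'a arrow) cat" where
  "concrete_cat \<O> = \<lparr>
     Obj = \<O>,
     Arr = {(R, f, S). R \<in> \<O> \<and> S \<in> \<O> \<and> f \<in> op_hom R S \<and> f \<in> extensional (carrier R)},
     Dom = (\<lambda>(R, f, S). R),
     Cod = (\<lambda>(R, f, S). S),
     Ident = (\<lambda>R. (R, \<lambda>x \<in> carrier R. x, R)),
     Cmp = (\<lambda>(S, g, T) (R, f, S'). (R, compose (carrier R) g f, T))\<rparr>"

definition LSkRng :: "('a op_group, 'a arrow) cat" where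
  "LSkRng = concrete_cat {R. left_skew_ring R \<and> normalized R}"

definition LWkRng :: "('a op_group, 'a arrow) cat" where
  "LWkRng = concrete_cat {W. left_weak_ring W \<and> normalized W}"

definition weak_of_skew :: "'a op_group \<Rightarrow> 'a op_group" where
  "weak_of_skew R = R\<lparr>bop := norm_op (carrier R) (\<lambda>a b. (\<ominus>\<^bsub>R\<^esub> a) \<oplus>\<^bsub>R\<^esub> (a \<odot>\<^bsub>R\<^esub> b))\<rparr>"

definition canonical_ftor :: "('a op_group, 'a arrow, 'a op_group, 'a arrow) ftor" where
  "canonical_ftor = \<lparr>
     on_obj = weak_of_skew,
     on_arr = (\<lambda>(R, f, S). (weak_of_skew R, f, weak_of_skew S))\<rparr>"

end

theory Submission
  imports Defs
begin

text \<open>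
  In a left skew ring, skew distributivity says exactly that \<open>b \<mapsto> - a + a \<circ> b\<close> is additive, and in
  terms of the operation \<open>a \<cdot> b = - a + a \<circ> b\<close>, that is \<open>a \<circ> b = a + a \<cdot> b\<close>, associativity of \<open>\<circ>\<close>
  becomes weak associativity of \<open>\<cdot>\<close>. The two assignments are mutually inverse and keep the
  underlying group, and a group homomorphism preserves one of the two operations if and only if
  it preserves the other.
\<close>

section \<open>Categories of structures and operation-preserving mappings\<close>

lemma concrete_cat_simps [simp]:
  "Obj (concrete_cat \<O>) = \<O>"
  "(R, f, S) \<in> Arr (concrete_cat \<O>) \<longleftrightarrow>
    R \<in> \<O> \<and> S \<in> \<O> \<and> f \<in> op_hom R S \<and> f \<in> extensional (carrier R)"
  "Dom (concrete_cat \<O>) (R, f, S) = R"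
  "Cod (concrete_cat \<O>) (R, f, S) = S"
  "Ident (concrete_cat \<O>) R = (R, \<lambda>x \<in> carrier R. x, R)"
  "Cmp (concrete_cat \<O>) (S', g, T) (R, f, S) = (R, compose (carrier R) g f, T)"
  by (simp_all add: concrete_cat_def)

text \<open>Common to both kinds of rings. Identities and composites are restricted to the carrier,
  so their values at a sum or a product are as expected only when these lie in the carrier.\<close>

definition op_closed :: "('a, 'm) op_group_scheme \<Rightarrow> bool" where
  "op_closed R \<longleftrightarrow> (\<forall>a \<in> carrier R. \<forall>b \<in> carrier R.
     a \<oplus>\<^bsub>R\<^esub> b \<in> carrier R \<and> a \<odot>\<^bsub>R\<^esub> b \<in> carrier R)"

lemma op_homI:
  assumes "\<And>a. a \<in> carrier R \<Longrightarrow> f a \<in> carrier S"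
    and "\<And>a b. \<lbrakk>a \<in> carrier R; b \<in> carrier R\<rbrakk> \<Longrightarrow> f (a \<oplus>\<^bsub>R\<^esub> b) = f a \<oplus>\<^bsub>S\<^esub> f b"
    and "\<And>a b. \<lbrakk>a \<in> carrier R; b \<in> carrier R\<rbrakk> \<Longrightarrow> f (a \<odot>\<^bsub>R\<^esub> b) = f a \<odot>\<^bsub>S\<^esub> f b"
  shows "f \<in> op_hom R S"
  using assms by (auto simp: op_hom_def hom_def)

lemma op_homD:
  assumes "f \<in> op_hom R S"
  shows "a \<in> carrier R \<Longrightarrow> f a \<in> carrier S"
    and "\<lbrakk>a \<in> carrier R; b \<in> carrier R\<rbrakk> \<Longrightarrow> f (a \<oplus>\<^bsub>R\<^esub> b) = f a \<oplus>\<^bsub>S\<^esub> f b"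
    and "\<lbrakk>a \<in> carrier R; b \<in> carrier R\<rbrakk> \<Longrightarrow> f (a \<odot>\<^bsub>R\<^esub> b) = f a \<odot>\<^bsub>S\<^esub> f b"
  using assms by (auto simp: op_hom_def hom_def)

lemma op_hom_id:
  assumes "op_closed R"
  shows "(\<lambda>x \<in> carrier R. x) \<in> op_hom R R"
  using assms by (auto simp: op_closed_def intro!: op_homI)

lemma op_hom_compose:
  assumes "op_closed R" and "f \<in> op_hom R S" and "g \<in> op_hom S T"
  shows "compose (carrier R) g f \<in> op_hom R T"
  using assms
  by (auto simp: op_closed_def compose_def op_homD[OF assms(2)] op_homD[OF assms(3)]
      intro!: op_homI)

lemma category_concrete_cat:
  assumes "\<And>R. R \<in> \<O> \<Longrightarrow> op_closed R"
  shows "category (concrete_cat \<O>)"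
proof
  fix f g h assume
    "f \<in> Arr (concrete_cat \<O>)" "g \<in> Arr (concrete_cat \<O>)" "h \<in> Arr (concrete_cat \<O>)"
    "Cod (concrete_cat \<O>) f = Dom (concrete_cat \<O>) g"
    "Cod (concrete_cat \<O>) g = Dom (concrete_cat \<O>) h"
  then show "Cmp (concrete_cat \<O>) h (Cmp (concrete_cat \<O>) g f)
      = Cmp (concrete_cat \<O>) (Cmp (concrete_cat \<O>) h g) f"
    by (cases f; cases g; cases h) (auto simp: compose_def fun_eq_iff dest: op_homD(1))
next
  fix f assume "f \<in> Arr (concrete_cat \<O>)"
  then show "Cmp (concrete_cat \<O>) f (Ident (concrete_cat \<O>) (Dom (concrete_cat \<O>) f)) = f"
    \<comment> \<open>Extensionality makes this an equality of HOL functions: off the carrier both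
      sides are \<open>undefined\<close>.\<close>
    by (cases f) (auto simp: compose_def extensional_def fun_eq_iff)
next
  fix f assume "f \<in> Arr (concrete_cat \<O>)"
  then show "Cmp (concrete_cat \<O>) (Ident (concrete_cat \<O>) (Cod (concrete_cat \<O>) f)) f = f"
    by (cases f) (auto simp: compose_def extensional_def fun_eq_iff op_homD(1))
qed (auto simp: assms op_hom_id op_hom_compose)

section \<open>Functors that change the objects and keep the mappings\<close>

definition relabel :: "('a op_group \<Rightarrow> 'a op_group) \<Rightarrow>
    ('a op_group, 'a arrow, 'a op_group, 'a arrow) ftor" where
  "relabel \<Phi> = \<lparr>on_obj = \<Phi>, on_arr = (\<lambda>(R, f, S). (\<Phi> R, f, \<Phi> S))\<rparr>"

text \<open>Since \<Phi> keeps carriers, extensionality, identities and composites refer to the same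
  set before and after relabelling; the inclusion of hom sets then makes the unchanged mapping an
  arrow.\<close>

lemma is_functor_relabel:
  assumes "\<And>R. R \<in> \<O> \<Longrightarrow> op_closed R" and "\<And>R. R \<in> \<O>' \<Longrightarrow> op_closed R"
    and "\<And>R. R \<in> \<O> \<Longrightarrow> \<Phi> R \<in> \<O>'" and "\<And>R. R \<in> \<O> \<Longrightarrow> carrier (\<Phi> R) = carrier R"
    and "\<And>R S. \<lbrakk>R \<in> \<O>; S \<in> \<O>\<rbrakk> \<Longrightarrow> op_hom R S \<subseteq> op_hom (\<Phi> R) (\<Phi> S)"
  shows "is_functor (concrete_cat \<O>) (concrete_cat \<O>') (relabel \<Phi>)"
proof (intro is_functor.intro category_concrete_cat is_functor_axioms.intro)
  fix f assume "f \<in> Arr (concrete_cat \<O>)"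
  then show "on_arr (relabel \<Phi>) f \<in> Arr (concrete_cat \<O>')"
    using assms(3,4) assms(5)[THEN subsetD] by (cases f) (simp add: relabel_def)
qed (auto simp: relabel_def assms(1-4))

text \<open>Inverse object maps suffice: an arrow differs from its image only in its two endpoints,
  and these return to themselves.\<close>

lemma is_cat_isomorphism_relabel:
  assumes "is_functor (concrete_cat \<O>) (concrete_cat \<O>') (relabel \<Phi>)"
    and "is_functor (concrete_cat \<O>') (concrete_cat \<O>) (relabel \<Psi>)"
    and "\<And>R. R \<in> \<O> \<Longrightarrow> \<Psi> (\<Phi> R) = R" and "\<And>R. R \<in> \<O>' \<Longrightarrow> \<Phi> (\<Psi> R) = R"
  shows "is_cat_isomorphism (concrete_cat \<O>) (concrete_cat \<O>') (relabel \<Phi>)"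
  unfolding is_cat_isomorphism_def
proof (intro conjI exI[of _ "relabel \<Psi>"])
qed (use assms in \<open>auto simp: ftor_eq_def comp_ftor_def id_ftor_def relabel_def\<close>)

section \<open>Replacing the second operation over a fixed group\<close>

lemma group_bop_update [simp]: "group (R\<lparr>bop := p\<rparr>) \<longleftrightarrow> group R"
proof -
  have "carrier (R\<lparr>bop := p\<rparr>) = carrier R" "mult (R\<lparr>bop := p\<rparr>) = mult R"
    "one (R\<lparr>bop := p\<rparr>) = one R"
    by simp_all
  then show ?thesis
    unfolding group_def group_axioms_def monoid_def Units_def by (simp only:)
qed

lemma m_inv_bop_update [simp]: "m_inv (R\<lparr>bop := p\<rparr>) = m_inv R"
  by (simp add: m_inv_def fun_eq_iff)

lemma norm_op_apply [simp]: "\<lbrakk>a \<in> A; b \<in> A\<rbrakk> \<Longrightarrow> norm_op A p a b = p a b"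
  by (simp add: norm_op_def)

lemma norm_op_idem [simp]: "norm_op A (norm_op A p) = norm_op A p"
  by (simp add: norm_op_def fun_eq_iff)

lemma norm_op_cong: "(\<And>a b. \<lbrakk>a \<in> A; b \<in> A\<rbrakk> \<Longrightarrow> p a b = q a b) \<Longrightarrow> norm_op A p = norm_op A q"
  by (auto simp: norm_op_def fun_eq_iff)

lemma normalized_bop_update:
  "normalized R \<Longrightarrow> normalized (R\<lparr>bop := norm_op (carrier R) p\<rparr>)"
  by (simp add: normalized_def)

text \<open>The candidate inverse on objects, obtained by solving
  \<open>a \<cdot> b = - a + a \<circ> b\<close> for \<open>a \<circ> b\<close>. The use of
  \<open>norm_op\<close> keeps the record normalized.\<close>

definition skew_of_weak :: "'a op_group \<Rightarrow> 'a op_group" where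
  "skew_of_weak W = W\<lparr>bop := norm_op (carrier W) (\<lambda>a b. a \<oplus>\<^bsub>W\<^esub> (a \<odot>\<^bsub>W\<^esub> b))\<rparr>"

lemma weak_of_skew_simps [simp]:
  "carrier (weak_of_skew R) = carrier R"
  "mult (weak_of_skew R) = mult R"
  "one (weak_of_skew R) = one R"
  "m_inv (weak_of_skew R) = m_inv R"
  "group (weak_of_skew R) \<longleftrightarrow> group R"
  "\<lbrakk>a \<in> carrier R; b \<in> carrier R\<rbrakk> \<Longrightarrow>
    a \<odot>\<^bsub>weak_of_skew R\<^esub> b = (\<ominus>\<^bsub>R\<^esub> a) \<oplus>\<^bsub>R\<^esub> (a \<odot>\<^bsub>R\<^esub> b)"
  by (simp_all add: weak_of_skew_def)

lemma skew_of_weak_simps [simp]: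
  "carrier (skew_of_weak W) = carrier W"
  "mult (skew_of_weak W) = mult W"
  "one (skew_of_weak W) = one W"
  "m_inv (skew_of_weak W) = m_inv W"
  "group (skew_of_weak W) \<longleftrightarrow> group W"
  "\<lbrakk>a \<in> carrier W; b \<in> carrier W\<rbrakk> \<Longrightarrow>
    a \<odot>\<^bsub>skew_of_weak W\<^esub> b = a \<oplus>\<^bsub>W\<^esub> (a \<odot>\<^bsub>W\<^esub> b)"
  by (simp_all add: skew_of_weak_def)

section \<open>Cancellation, and zero and negatives under the skew operation\<close>

context group
begin

lemma inv_mult_cancel [simp]:
  "\<lbrakk>a \<in> carrier G; b \<in> carrier G\<rbrakk> \<Longrightarrow> (\<ominus> a) \<oplus> (a \<oplus> b) = b"
  "\<lbrakk>a \<in> carrier G; b \<in> carrier G\<rbrakk> \<Longrightarrow> a \<oplus> ((\<ominus> a) \<oplus> b) = b"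
  by (simp_all add: m_assoc[symmetric])

end

context left_skew_ring
begin

text \<open>Skew distributivity at \<open>0 + 0\<close> gives
  \<open>a \<circ> 0 = a \<circ> 0 - a + a \<circ> 0\<close>; cancel \<open>a \<circ> 0\<close> on
  the left.\<close>

lemma circ_zero:
  assumes "a \<in> carrier R"
  shows "a \<odot> \<one> = a"
proof -
  have "(a \<odot> \<one>) \<oplus> ((\<ominus> a) \<oplus> (a \<odot> \<one>)) = (a \<odot> \<one>) \<oplus> \<one>"
    using circ_skew_distrib[of a \<one> \<one>] assms by (simp add: circ_closed m_assoc)
  then have eq: "(\<ominus> a) \<oplus> (a \<odot> \<one>) = \<one>"
    \<comment> \<open>Without \<open>r_one\<close> the right side stays a sum, so that both sides
      show the left summand to be cancelled.\<close>
    using assms by (simp add: circ_closed del: r_one)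
  have "a \<odot> \<one> = a \<oplus> ((\<ominus> a) \<oplus> (a \<odot> \<one>))"
    using assms by (simp add: circ_closed)
  then show ?thesis
    using assms by (simp add: eq)
qed

text \<open>Expand \<open>a \<circ> (b + (- b))\<close>, which equals \<open>a\<close> by
  \<open>circ_zero\<close>, and solve for the last summand.\<close>

lemma circ_neg:
  assumes "a \<in> carrier R" and "b \<in> carrier R"
  shows "a \<odot> (\<ominus> b) = a \<oplus> ((\<ominus> (a \<odot> b)) \<oplus> a)"
proof -
  have eq: "(a \<odot> b) \<oplus> ((\<ominus> a) \<oplus> (a \<odot> (\<ominus> b))) = a"
    using circ_skew_distrib[of a b "\<ominus> b"] assms by (simp add: circ_closed circ_zero m_assoc)
  have "a \<odot> (\<ominus> b)
      = a \<oplus> ((\<ominus> (a \<odot> b)) \<oplus> ((a \<odot> b) \<oplus> ((\<ominus> a) \<oplus> (a \<odot> (\<ominus> b)))))"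
    using assms by (simp add: circ_closed)
  then show ?thesis
    by (simp only: eq)
qed

end

section \<open>Passing between the two kinds of rings\<close>

lemma left_weak_ring_weak_of_skew:
  fixes R (structure)
  assumes "left_skew_ring R"
  shows "left_weak_ring (weak_of_skew R)"
proof -
  interpret left_skew_ring R by fact
  show ?thesis
  proof (intro left_weak_ring.intro left_weak_ring_axioms.intro, unfold weak_of_skew_simps(1-5))
    show "group R"
      by (rule is_group)
  next
    fix a b assume "a \<in> carrier R" and "b \<in> carrier R"
    then show "a \<odot>\<^bsub>weak_of_skew R\<^esub> b \<in> carrier R"
      by (simp add: circ_closed)
  next
    fix a b c assume abc: "a \<in> carrier R" "b \<in> carrier R" "c \<in> carrier R"
    note closed = abc circ_closed
    \<comment> \<open>This is the right side of weak associativity with \<open>a\<close> added in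
      front. As \<open>a + a \<cdot> b = a \<circ> b\<close>, the left side is
      \<open>- (a \<circ> b) + (a \<circ> b) \<circ> c\<close>, and associativity identifies the
      two.\<close>
    have "a \<odot> ((\<ominus> b) \<oplus> (b \<odot> c))
        = a \<oplus> ((\<ominus> (a \<odot> b)) \<oplus> (a \<odot> (b \<odot> c)))"
      using closed by (simp add: circ_skew_distrib circ_neg m_assoc)
    then show "(a \<oplus> (a \<odot>\<^bsub>weak_of_skew R\<^esub> b)) \<odot>\<^bsub>weak_of_skew R\<^esub> c
        = a \<odot>\<^bsub>weak_of_skew R\<^esub> (b \<odot>\<^bsub>weak_of_skew R\<^esub> c)"
      using closed by (simp add: circ_assoc)
    show "a \<odot>\<^bsub>weak_of_skew R\<^esub> (b \<oplus> c)
        = (a \<odot>\<^bsub>weak_of_skew R\<^esub> b) \<oplus> (a \<odot>\<^bsub>weak_of_skew R\<^esub> c)"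
      using closed by (simp add: circ_skew_distrib m_assoc)
  qed
qed

text \<open>Both bracketings of a triple product become
  \<open>a + a \<cdot> b + a \<cdot> (b \<cdot> c)\<close>, one by distributivity and the other by
  weak associativity. In skew distributivity the middle \<open>- a\<close> cancels the
  \<open>a\<close> that begins \<open>a \<circ> c\<close>.\<close>

lemma left_skew_ring_skew_of_weak:
  assumes "left_weak_ring W"
  shows "left_skew_ring (skew_of_weak W)"
proof -
  interpret left_weak_ring W by fact
  show ?thesis
  proof (intro left_skew_ring.intro left_skew_ring_axioms.intro)
    show "group (skew_of_weak W)"
      by (simp add: is_group)
  qed (simp_all add: dot_closed dot_weak_assoc dot_distrib m_assoc)
qed

text \<open>On the carrier \<open>a + (- a + a \<circ> b) = a \<circ> b\<close>; normalization
  extends this to equality of records.\<close>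

lemma skew_of_weak_of_skew:
  assumes "left_skew_ring R" and "normalized R"
  shows "skew_of_weak (weak_of_skew R) = R"
proof -
  interpret left_skew_ring R by fact
  have "bop (skew_of_weak (weak_of_skew R)) = norm_op (carrier R) (bop R)"
    unfolding skew_of_weak_def by (auto simp: circ_closed intro: norm_op_cong)
  also have "\<dots> = bop R"
    using assms(2) by (simp add: normalized_def)
  finally show ?thesis
    by (intro op_group.equality) simp_all
qed

lemma weak_of_skew_of_weak:
  assumes "left_weak_ring W" and "normalized W"
  shows "weak_of_skew (skew_of_weak W) = W"
proof -
  interpret left_weak_ring W by fact
  have "bop (weak_of_skew (skew_of_weak W)) = norm_op (carrier W) (bop W)"
    unfolding weak_of_skew_def by (auto simp: dot_closed intro: norm_op_cong)
  also have "\<dots> = bop W"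
    using assms(2) by (simp add: normalized_def)
  finally show ?thesis
    by (intro op_group.equality) simp_all
qed

section \<open>Morphisms of the two kinds of rings\<close>

lemma op_hom_weak_of_skew:
  assumes "left_skew_ring R" and "left_skew_ring S"
  shows "op_hom R S \<subseteq> op_hom (weak_of_skew R) (weak_of_skew S)"
proof
  fix f assume f: "f \<in> op_hom R S"
  interpret R: left_skew_ring R by fact
  interpret S: left_skew_ring S by fact
  have "f \<in> hom R S"
    using f by (simp add: op_hom_def)
  \<comment> \<open>The weak operation involves \<open>- a\<close>, so \<open>f\<close> has to
    preserve negatives, as a homomorphism of groups does.\<close>
  then interpret group_hom R S f
    by unfold_locales
  show "f \<in> op_hom (weak_of_skew R) (weak_of_skew S)"
    by (rule op_homI) (simp_all add: R.circ_closed op_homD(3)[OF f])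
qed

lemma op_hom_skew_of_weak:
  assumes "left_weak_ring R"
  shows "op_hom R S \<subseteq> op_hom (skew_of_weak R) (skew_of_weak S)"
proof
  fix f assume f: "f \<in> op_hom R S"
  interpret R: left_weak_ring R by fact
  show "f \<in> op_hom (skew_of_weak R) (skew_of_weak S)"
    by (rule op_homI) (simp_all add: R.dot_closed op_homD[OF f])
qed

lemma left_skew_ring_op_closed:
  assumes "left_skew_ring R"
  shows "op_closed R"
proof -
  interpret left_skew_ring R by fact
  show ?thesis
    by (simp add: op_closed_def circ_closed)
qed

lemma left_weak_ring_op_closed:
  assumes "left_weak_ring W"
  shows "op_closed W"
proof -
  interpret left_weak_ring W by fact
  show ?thesis
    by (simp add: op_closed_def dot_closed)
qed

theorem theorem4p5:
  shows "is_cat_isomorphism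
           (LSkRng :: ('a op_group, 'a arrow) cat) (LWkRng :: ('a op_group, 'a arrow) cat)
           (canonical_ftor :: ('a op_group, 'a arrow, 'a op_group, 'a arrow) ftor)"
proof -
  have canonical: "canonical_ftor = relabel weak_of_skew"
    by (simp add: canonical_ftor_def relabel_def)
  have weak_normalized: "normalized (weak_of_skew R)" if "normalized R" for R :: "'a op_group"
    using that unfolding weak_of_skew_def by (rule normalized_bop_update)
  have skew_normalized: "normalized (skew_of_weak R)" if "normalized R" for R :: "'a op_group"
    using that unfolding skew_of_weak_def by (rule normalized_bop_update)
  show ?thesis
    unfolding canonical LSkRng_def LWkRng_def
  \<comment> \<open>The inverse functor relabels by \<open>skew_of_weak\<close>. What remains is
    closure, preservation of objects, carriers and morphisms in both directions, and the two round
    trips on objects.\<close>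
  proof (intro is_cat_isomorphism_relabel[where \<Psi> = skew_of_weak] is_functor_relabel)
  qed (simp_all add: left_skew_ring_op_closed left_weak_ring_op_closed
      left_weak_ring_weak_of_skew left_skew_ring_skew_of_weak weak_normalized skew_normalized
      op_hom_weak_of_skew op_hom_skew_of_weak skew_of_weak_of_skew weak_of_skew_of_weak)
qed

end
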